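(* For the Poisson $i\mathcal{S}$-graph with legitimate-node density $\lambda_\ell>0$, eavesdropper density $\lambda_{\mathrm e}>0$, secrecy rate threshold $\varrho\ge 0$, noise powers $\sigma_\ell^2,\sigma_{\mathrm e}^2>0$, transmit power $P_\ell>0$, path loss only, and channel gain function $g(r)=\frac{1}{r^{2b}}$, the average node degrees of a typical node satisfy $$\mathbb{E}\{N_{\mathrm{in}}\}=\mathbb{E}\{N_{\mathrm{out}}\}=\pi^{2}\lambda_\ell\lambda_{\mathrm e}\int_{0}^{\infty}\frac{x\,e^{-\pi\lambda_{\mathrm e}x}}{\left(\frac{\sigma_\ell^2}{\sigma_{\mathrm e}^2}2^{\varrho}+\frac{\sigma_\ell^2}{P_\ell}(2^{\varrho}-1)x^{b}\right)^{1/b}}\,dx$$ and $$\mathbb{E}\{N_{\mathrm{in}}\}=\mathbb{E}\{N_{\mathrm{out}}\}\le\frac{\lambda_\ell}{\lambda_{\mathrm e}}\,\frac{1}{\left(\frac{\sigma_\ell^2}{\sigma_{\mathrm e}^2}2^{\varrho}+\frac{\sigma_\ell^2}{P_\ell(\pi\lambda_{\mathrm e})^{b}}(2^{\varrho}-1)\right)^{1/b}}.$$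
   Context: $\Pi_\ell$ (legitimate nodes) and $\Pi_{\mathrm e}$ (eavesdroppers) are mutually independent homogeneous Poisson point processes on $\mathbb{R}^2$ with densities $\lambda_\ell,\lambda_{\mathrm e}>0$. The exponent $b>0$ is the amplitude loss exponent. $i\mathcal{S}$-graph: the directed graph on the legitimate nodes with edge $\overrightarrow{xy}$ if and only if $\mathcal{R}_{\mathrm s}(x,y)>\varrho$, where (path loss only) $$\mathcal{R}_{\mathrm s}(x,y)=\left[\log_2\left(1+\frac{P_\ell\, g(|x-y|)}{\sigma_\ell^2}\right)-\log_2\left(1+\frac{P_\ell\, g(|x-e^*|)}{\sigma_{\mathrm e}^2}\right)\right]^+,\qquad e^*=\operatorname*{argmin}_{e\in\Pi_{\mathrm e}}|x-e|,$$ and $[t]^+=\max\{t,0\}$. Equivalently (for $\varrho\ge0$), the edge is present iff $g(|x-y|)>\frac{\sigma_\ell^2}{\sigma_{\mathrm e}^2}2^{\varrho}g(|x-e^*|)+\frac{\sigma_\ell^2}{P_\ell}(2^{\varrho}-1)$. Typical node: the node at the origin when the graph is built on the legitimate-node set $\Pi_\ell\cup\{0\}$ with eavesdroppers $\Pi_{\mathrm e}$. $N_{\mathrm{out}}$ (resp. $N_{\mathrm{in}}$) is the number of $x\in\Pi_\ell$ with an edge $\overrightarrow{0x}$ (resp. $\overrightarrow{x0}$). *)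

theory Defs
  imports "HOL-Probability.Probability"
begin

text \<open>
  A (simple) point process is a random locally finite set \<open>\<Phi>\<close>. For bounded \<open>A\<close> the number of its
  points in \<open>A\<close> is the finite number \<open>card (\<Phi> \<omega> \<inter> A)\<close>.
\<close>

locale homogeneous_poisson_process = prob_space M
  for M :: "'w measure" +
  fixes lam :: real and \<Phi> :: "'w \<Rightarrow> 'a::euclidean_space set"
  assumes locally_finite:
      "\<lbrakk>\<omega> \<in> space M; bounded A\<rbrakk> \<Longrightarrow> finite (\<Phi> \<omega> \<inter> A)"
    and count_measurable:
      "\<lbrakk>A \<in> sets borel; bounded A\<rbrakk> \<Longrightarrow>
        random_variable (count_space UNIV) (\<lambda>\<omega>. card (\<Phi> \<omega> \<inter> A))"
    and count_poisson:
      "\<lbrakk>A \<in> sets borel; bounded A\<rbrakk> \<Longrightarrow>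
        prob {\<omega> \<in> space M. card (\<Phi> \<omega> \<inter> A) = k} =
          (lam * measure lborel A) ^ k / fact k * exp (- (lam * measure lborel A))"
    and count_indep:
      "\<lbrakk>\<And>i. i < n \<Longrightarrow> B i \<in> sets borel; \<And>i. i < n \<Longrightarrow> bounded (B i);
        disjoint_family_on B {..<n}\<rbrakk> \<Longrightarrow>
        indep_vars (\<lambda>_. count_space UNIV) (\<lambda>i \<omega>. card (\<Phi> \<omega> \<inter> B i)) {..<(n::nat)}"

definition point_process_events ::
    "'w measure \<Rightarrow> ('w \<Rightarrow> 'a::euclidean_space set) \<Rightarrow> 'w set set" where
  "point_process_events M \<Phi> = sigma_sets (space M)
     {{\<omega> \<in> space M. card (\<Phi> \<omega> \<inter> A) = k} | A k. A \<in> sets borel \<and> bounded A}"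

definition indep_point_processes ::
    "'w measure \<Rightarrow> ('w \<Rightarrow> 'a::euclidean_space set) \<Rightarrow> ('w \<Rightarrow> 'a set) \<Rightarrow> bool" where
  "indep_point_processes M \<Phi> \<Phi>' \<longleftrightarrow>
     prob_space.indep_set M (point_process_events M \<Phi>) (point_process_events M \<Phi>')"

text \<open>
  At \<open>r = 0\<close> the gain is infinite mathematically and \<open>0\<close> here. This matters only if two points
  among the origin, the legitimate nodes and the eavesdroppers coincide, which has probability
  \<open>0\<close>; for \<open>\<rho> \<ge> 0\<close> no node then has a loop.
\<close>

definition path_loss_gain :: "real \<Rightarrow> real \<Rightarrow> real" where
  "path_loss_gain b r = 1 / r powr (2 * b)"

text \<open>
  The nearest eavesdropper exists whenever \<open>E\<close> is nonempty and locally finite, and the choice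
  among several nearest ones does not affect the distance to it.
\<close>

definition nearest :: "'a::metric_space set \<Rightarrow> 'a \<Rightarrow> 'a" where
  "nearest E x = arg_min_on (\<lambda>e. dist x e) E"

text \<open>
  In what follows \<open>P\<close> is the transmit power, \<open>\<sigma>l\<^sup>2\<close> and \<open>\<sigma>e\<^sup>2\<close> are the noise powers of the
  legitimate nodes and of the eavesdroppers, \<open>L\<close> and \<open>E\<close> are the sets of nodes of the two kinds,
  and \<open>\<rho>\<close> is the secrecy rate threshold.
\<close>

definition max_secrecy_rate ::
    "(real \<Rightarrow> real) \<Rightarrow> real \<Rightarrow> real \<Rightarrow> real \<Rightarrow> 'a::metric_space set \<Rightarrow> 'a \<Rightarrow> 'a \<Rightarrow> real" where
  "max_secrecy_rate g P \<sigma>l \<sigma>e E x y =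
     max (log 2 (1 + P * g (dist x y) / \<sigma>l\<^sup>2) - log 2 (1 + P * g (dist x (nearest E x)) / \<sigma>e\<^sup>2)) 0"

definition iS_graph ::
    "(real \<Rightarrow> real) \<Rightarrow> real \<Rightarrow> real \<Rightarrow> real \<Rightarrow> real \<Rightarrow> 'a::metric_space set \<Rightarrow> 'a set \<Rightarrow> ('a \<times> 'a) set"
  where
  "iS_graph g P \<sigma>l \<sigma>e \<rho> L E =
     {(x, y). x \<in> L \<and> y \<in> L \<and> max_secrecy_rate g P \<sigma>l \<sigma>e E x y > \<rho>}"

text \<open>
  Degrees of the typical node take values in \<^typ>\<open>ennreal\<close> so that an infinite degree is counted
  as \<open>\<infinity>\<close>.
\<close>

definition typical_out_degree ::
    "(real \<Rightarrow> real) \<Rightarrow> real \<Rightarrow> real \<Rightarrow> real \<Rightarrow> real \<Rightarrow> 'a::real_normed_vector set \<Rightarrow> 'a set \<Rightarrow> ennreal"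
  where
  "typical_out_degree g P \<sigma>l \<sigma>e \<rho> L E =
     emeasure (count_space UNIV) {x \<in> L. (0, x) \<in> iS_graph g P \<sigma>l \<sigma>e \<rho> (L \<union> {0}) E}"

definition typical_in_degree ::
    "(real \<Rightarrow> real) \<Rightarrow> real \<Rightarrow> real \<Rightarrow> real \<Rightarrow> real \<Rightarrow> 'a::real_normed_vector set \<Rightarrow> 'a set \<Rightarrow> ennreal"
  where
  "typical_in_degree g P \<sigma>l \<sigma>e \<rho> L E =
     emeasure (count_space UNIV) {x \<in> L. (x, 0) \<in> iS_graph g P \<sigma>l \<sigma>e \<rho> (L \<union> {0}) E}"

end

theory Submission
  imports Defs
begin

text \<open>
  By Campbell's formula, a Poisson process that is independent of its marking has, on average,
  \<open>\<lambda>\<^sub>l \<integral> P(x is marked) dx\<close> marked points. Let \<open>D\<close> be the distance from a fixed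
  point to the nearest eavesdropper. The void probabilities show that \<open>D\<^sup>2\<close> is exponentially
  distributed with rate \<open>\<pi> \<lambda>\<^sub>e\<close> for every such point, and the edge condition reads
  \<open>|x|\<^sup>2 < f(D\<^sup>2)\<close> with \<open>f(s) = s / (c\<^sub>1 + c\<^sub>2 s\<^sup>b)\<^sup>1\<^sup>/\<^sup>b\<close>. Integrating over \<open>x\<close> first gives the
  mean degree \<open>\<pi> \<lambda>\<^sub>l E f(D\<^sup>2)\<close>, which is the stated integral. As \<open>f\<close> is concave, Jensen's
  inequality bounds it by \<open>\<pi> \<lambda>\<^sub>l f(1 / (\<pi> \<lambda>\<^sub>e))\<close>.
\<close>

subsection \<open>Campbell's formula for independently marked Poisson processes\<close>

text \<open>Marks are encoded by pairs of a location and an outcome, so whether a point is marked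
  may depend on the randomness. For a fixed outcome the count is counting measure of a section,
  hence a measure in \<open>H\<close>.\<close>

definition marked_count :: "('w \<Rightarrow> 'a set) \<Rightarrow> ('a \<times> 'w) set \<Rightarrow> 'w \<Rightarrow> ennreal" where
  "marked_count \<Phi> H \<omega> = emeasure (count_space UNIV) {x \<in> \<Phi> \<omega>. (x, \<omega>) \<in> H}"

lemma marked_count_Sup:
  assumes "incseq H"
  shows "marked_count \<Phi> (\<Union>n. H n) \<omega> = (SUP n. marked_count \<Phi> (H n) \<omega>)"
proof -
  have "incseq (\<lambda>n. {x \<in> \<Phi> \<omega>. (x, \<omega>) \<in> H n})"
    using assms by (fastforce simp: incseq_def)
  then have "(SUP n. marked_count \<Phi> (H n) \<omega>)
      = emeasure (count_space UNIV) (\<Union>n. {x \<in> \<Phi> \<omega>. (x, \<omega>) \<in> H n})"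
    unfolding marked_count_def by (intro SUP_emeasure_incseq) auto
  also have "(\<Union>n. {x \<in> \<Phi> \<omega>. (x, \<omega>) \<in> H n}) = {x \<in> \<Phi> \<omega>. (x, \<omega>) \<in> (\<Union>n. H n)}"
    by auto
  finally show ?thesis by (simp add: marked_count_def)
qed

lemma marked_count_suminf:
  assumes "disjoint_family H"
  shows "marked_count \<Phi> (\<Union>n. H n) \<omega> = (\<Sum>n. marked_count \<Phi> (H n) \<omega>)"
proof -
  have "(\<Sum>n. marked_count \<Phi> (H n) \<omega>)
      = emeasure (count_space UNIV) (\<Union>n. {x \<in> \<Phi> \<omega>. (x, \<omega>) \<in> H n})"
    unfolding marked_count_def using assms
    by (intro suminf_emeasure) (auto simp: disjoint_family_on_def)
  also have "(\<Union>n. {x \<in> \<Phi> \<omega>. (x, \<omega>) \<in> H n}) = {x \<in> \<Phi> \<omega>. (x, \<omega>) \<in> (\<Union>n. H n)}"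
    by auto
  finally show ?thesis by (simp add: marked_count_def)
qed

lemma incseq_ball_Times: "incseq (\<lambda>n. (A \<inter> ball c (real n)) \<times> B)"
  by (auto simp: incseq_def)

context homogeneous_poisson_process
begin

lemma marked_count_Times:
  assumes "\<omega> \<in> space M" "bounded A"
  shows "marked_count \<Phi> (A \<times> B) \<omega> = of_nat (card (\<Phi> \<omega> \<inter> A)) * indicator B \<omega>"
proof (cases "\<omega> \<in> B")
  case True
  then have "{x \<in> \<Phi> \<omega>. (x, \<omega>) \<in> A \<times> B} = \<Phi> \<omega> \<inter> A" by auto
  with True locally_finite[OF assms] show ?thesis
    by (simp add: marked_count_def emeasure_count_space_finite)
qed (simp add: marked_count_def)

text \<open>Dynkin argument from measurable rectangles, where the count is a point count times an
  indicator. The bounded window \<open>B\<close> keeps all counts finite, so that the complement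
  step may subtract them.\<close>

lemma measurable_marked_count_bounded:
  assumes "bounded B" "B \<in> sets borel" "H \<in> sets (borel \<Otimes>\<^sub>M M)"
  shows "marked_count \<Phi> (H \<inter> B \<times> UNIV) \<in> borel_measurable M"
proof -
  have gen: "marked_count \<Phi> (A \<times> F \<inter> B \<times> UNIV) \<in> borel_measurable M"
    if "A \<in> sets borel" "F \<in> sets M" for A F
  proof -
    have "(\<lambda>\<omega>. of_nat (card (\<Phi> \<omega> \<inter> (A \<inter> B))) * indicator F \<omega> :: ennreal) \<in> borel_measurable M"
    proof (rule borel_measurable_times_ennreal)
      show "(\<lambda>\<omega>. of_nat (card (\<Phi> \<omega> \<inter> (A \<inter> B))) :: ennreal) \<in> borel_measurable M"
        using assms that by (intro measurable_compose[OF count_measurable]) (auto intro: bounded_subset)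
    qed (use that in auto)
    moreover have "marked_count \<Phi> ((A \<inter> B) \<times> F) \<omega> = of_nat (card (\<Phi> \<omega> \<inter> (A \<inter> B))) * indicator F \<omega>"
      if "\<omega> \<in> space M" for \<omega>
      using that assms by (intro marked_count_Times) (auto intro: bounded_subset)
    ultimately show ?thesis
      by (simp add: Times_Int_Times cong: measurable_cong)
  qed
  let ?G = "{A \<times> F |A F. A \<in> sets (borel :: 'a measure) \<and> F \<in> sets M}"
  have stable: "Int_stable ?G" by (rule Int_stable_pair_measure_generator)
  have closed: "?G \<subseteq> Pow (UNIV \<times> space M)"
    using pair_measure_closed[of "borel :: 'a measure" M] by simp
  have "H \<in> sigma_sets (UNIV \<times> space M) ?G"
    using assms(3) by (simp add: sets_pair_measure)
  then show ?thesis
  proof (induction rule: sigma_sets_induct_disjoint[OF stable closed, consumes 1, case_names basic empty compl union])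
    case (basic A)
    then show ?case using gen by auto
  next
    case empty
    then show ?case by (simp add: marked_count_def[abs_def])
  next
    case (compl A)
    have "marked_count \<Phi> ((UNIV \<times> space M - A) \<inter> B \<times> UNIV) \<omega>
        = marked_count \<Phi> (UNIV \<times> space M \<inter> B \<times> UNIV) \<omega> - marked_count \<Phi> (A \<inter> B \<times> UNIV) \<omega>"
      if "\<omega> \<in> space M" for \<omega>
    proof -
      have fin: "finite (\<Phi> \<omega> \<inter> B)" using locally_finite[OF that assms(1)] .
      have sub: "{x \<in> \<Phi> \<omega>. (x, \<omega>) \<in> A \<inter> B \<times> UNIV} \<subseteq> \<Phi> \<omega> \<inter> B" by auto
      have "{x \<in> \<Phi> \<omega>. (x, \<omega>) \<in> (UNIV \<times> space M - A) \<inter> B \<times> UNIV}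
        = {x \<in> \<Phi> \<omega>. (x, \<omega>) \<in> UNIV \<times> space M \<inter> B \<times> UNIV} - {x \<in> \<Phi> \<omega>. (x, \<omega>) \<in> A \<inter> B \<times> UNIV}"
        by auto
      then show ?thesis unfolding marked_count_def
        using finite_subset[OF sub fin] that
        by (simp only:) (rule emeasure_Diff; auto simp: emeasure_count_space_finite)
    qed
    moreover have "marked_count \<Phi> (UNIV \<times> space M \<inter> B \<times> UNIV) \<in> borel_measurable M"
      by (rule gen) auto
    ultimately show ?case using compl.IH
      by (simp cong: measurable_cong)
  next
    case (union A)
    have "marked_count \<Phi> ((\<Union>n. A n) \<inter> B \<times> UNIV) \<omega> = (\<Sum>n. marked_count \<Phi> (A n \<inter> B \<times> UNIV) \<omega>)" for \<omega>
      using union.hyps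
      by (subst marked_count_suminf[symmetric])
        (auto simp: disjoint_family_on_def intro!: arg_cong[where f="\<lambda>H. marked_count \<Phi> H \<omega>"])
    with union.IH show ?case
      by (simp cong: measurable_cong)
  qed
qed

lemma measurable_marked_count:
  assumes "H \<in> sets (borel \<Otimes>\<^sub>M M)"
  shows "marked_count \<Phi> H \<in> borel_measurable M"
proof -
  have "H = (\<Union>n. H \<inter> ball 0 (real n) \<times> UNIV)"
    using reals_Archimedean2 by auto
  moreover have "incseq (\<lambda>n. H \<inter> ball (0::'a) (real n) \<times> UNIV)"
    by (auto simp: incseq_def)
  ultimately have "marked_count \<Phi> H \<omega> = (SUP n. marked_count \<Phi> (H \<inter> ball 0 (real n) \<times> UNIV) \<omega>)" for \<omega>
    using marked_count_Sup by metis
  then show ?thesis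
    using measurable_marked_count_bounded[OF _ _ assms] by (simp cong: measurable_cong)
qed

text \<open>On a rectangle the marked count is the number of points in \<open>A\<close> times the
  indicator of \<open>B\<close>, and these are independent. Splitting by the value \<open>k\<close>
  of the number reduces this to independence of events and to the mean of the Poisson law.\<close>

lemma nn_integral_marked_count_Times_bounded:
  assumes A: "A \<in> sets borel" "bounded A" and lam: "0 < lam"
    and indep: "indep_set (point_process_events M \<Phi>) \<F>" and B: "B \<in> \<F>"
  shows "(\<integral>\<^sup>+\<omega>. marked_count \<Phi> (A \<times> B) \<omega> \<partial>M) = ennreal lam * emeasure lborel A * emeasure M B"
proof -
  define N where "N k = {\<omega> \<in> space M. card (\<Phi> \<omega> \<inter> A) = k}" for k
  define m where "m = lam * measure lborel A"
  have m: "0 \<le> m" using lam by (simp add: m_def)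
  have ev: "N k \<in> point_process_events M \<Phi>" for k
    unfolding N_def point_process_events_def using A by (intro sigma_sets.Basic) blast
  have [measurable]: "N k \<in> sets M" "B \<in> sets M" for k
    using indep_setD_ev1[OF indep] indep_setD_ev2[OF indep] ev B by auto
  have prob: "emeasure M (N k \<inter> B) = ennreal (m ^ k / fact k * exp (- m)) * emeasure M B" for k
    using indep_setD[OF indep ev B, of k] count_poisson[OF A, of k] m
    by (simp add: emeasure_eq_measure N_def m_def ennreal_mult' flip: ennreal_mult'')
  have "(\<integral>\<^sup>+\<omega>. marked_count \<Phi> (A \<times> B) \<omega> \<partial>M) = (\<integral>\<^sup>+\<omega>. (\<Sum>k. of_nat k * indicator (N k \<inter> B) \<omega>) \<partial>M)"
  proof (rule nn_integral_cong)
    fix \<omega> assume w: "\<omega> \<in> space M"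
    show "marked_count \<Phi> (A \<times> B) \<omega> = (\<Sum>k. of_nat k * indicator (N k \<inter> B) \<omega>)"
    proof (cases "\<omega> \<in> B")
      case True
      then have "(\<Sum>k. of_nat k * indicator (N k \<inter> B) \<omega> :: ennreal) = of_nat (card (\<Phi> \<omega> \<inter> A))"
        using w by (intro suminf_cmult_indicator) (auto simp: disjoint_family_on_def N_def)
      with True w A show ?thesis by (simp add: marked_count_Times)
    qed (use w A in \<open>simp add: marked_count_Times\<close>)
  qed
  also have "\<dots> = (\<Sum>k. of_nat k * emeasure M (N k \<inter> B))"
    by (subst nn_integral_suminf) (auto simp: nn_integral_cmult_indicator)
  also have "\<dots> = (\<Sum>k. ennreal (k * (m ^ k / fact k * exp (- m)))) * emeasure M B"
    using m by (simp add: prob ennreal_mult' ennreal_of_nat_eq_real_of_nat mult.assoc del: times_divide_eq_right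
        times_divide_eq_left flip: ennreal_suminf_multc)
  also have "(\<Sum>k. ennreal (k * (m ^ k / fact k * exp (- m)))) = ennreal m"
  proof -
    \<comment> \<open>Each \<open>k * m ^ k / fact k\<close> with \<open>k > 0\<close> is
      \<open>m\<close> times the preceding term of the exponential series. The term at
      \<open>k = 0\<close> vanishes, so the index shift leaves the sum unchanged.\<close>
    have "(\<lambda>k. m * exp (- m) * (m ^ k /\<^sub>R fact k)) sums (m * exp (- m) * exp m)"
      by (intro sums_mult exp_converges)
    then have "(\<lambda>k. real (Suc k) * (m ^ Suc k / fact (Suc k) * exp (- m))) sums m"
      by (simp add: field_simps exp_minus del: of_nat_Suc)
    then have "(\<lambda>k. real k * (m ^ k / fact k * exp (- m))) sums m"
      by (subst (asm) sums_Suc_iff) simp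
    then show ?thesis using m by (intro suminf_ennreal_eq) auto
  qed
  also have "ennreal m = ennreal lam * emeasure lborel A"
    using lam emeasure_bounded_finite[OF A(2)]
    by (simp add: m_def ennreal_mult emeasure_eq_ennreal_measure less_top)
  finally show ?thesis .
qed

text \<open>As a function of \<open>H\<close> the mean marked count is a measure. It agrees with the
  product of the intensity measure and the probability on rectangles, so uniqueness of product
  measures identifies the two; integrating the sections of \<open>H\<close> then gives the
  formula.\<close>

theorem nn_integral_marked_count:
  assumes lam: "0 < lam" and F: "subalgebra M F"
    and indep: "indep_set (point_process_events M \<Phi>) (sets F)"
    and H: "H \<in> sets (borel \<Otimes>\<^sub>M F)"
  shows "(\<integral>\<^sup>+\<omega>. marked_count \<Phi> H \<omega> \<partial>M)
    = ennreal lam * (\<integral>\<^sup>+x. emeasure M {\<omega> \<in> space M. (x, \<omega>) \<in> H} \<partial>lborel)"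
proof -
  \<comment> \<open>\<open>M1\<close> is the intensity measure and \<open>C\<close> the Campbell
    measure. \<open>M2\<close> restricts the probability to \<open>F\<close>, because rectangles are
    controlled only when their second side is an event of \<open>F\<close>.\<close>
  define M1 :: "'a measure" where "M1 = density lborel (\<lambda>_. ennreal lam)"
  define M2 where "M2 = restr_to_subalg M F"
  define C where "C = measure_of (UNIV \<times> space M) (sets (M1 \<Otimes>\<^sub>M M2)) (\<lambda>H. \<integral>\<^sup>+\<omega>. marked_count \<Phi> H \<omega> \<partial>M)"
  have sets2: "sets M2 = sets F" and space2: "space M2 = space M"
    using F by (simp_all add: M2_def sets_restr_to_subalg space_restr_to_subalg)
  have spaceF: "space F = space M" using F by (simp add: subalgebra_def)
  have setsP: "sets (M1 \<Otimes>\<^sub>M M2) = sets (borel \<Otimes>\<^sub>M F)"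
    using sets2 by (intro sets_pair_measure_cong) (simp_all add: M1_def)
  have spaceP: "space (M1 \<Otimes>\<^sub>M M2) = UNIV \<times> space M"
    by (simp add: space_pair_measure M1_def space2)
  have sub: "sets (borel \<Otimes>\<^sub>M F) \<subseteq> sets (borel \<Otimes>\<^sub>M M)"
    using F unfolding subalgebra_def sets_pair_measure spaceF by (intro sigma_sets_mono') auto
  have meas[measurable]: "marked_count \<Phi> H \<in> borel_measurable M" if "H \<in> sets (M1 \<Otimes>\<^sub>M M2)" for H
    using that sub setsP by (intro measurable_marked_count) auto
  have setsC: "sets C = sets (M1 \<Otimes>\<^sub>M M2)"
    unfolding C_def using sets.sets_measure_of_eq[of "M1 \<Otimes>\<^sub>M M2"] by (simp add: spaceP)
  have emC: "emeasure C H = (\<integral>\<^sup>+\<omega>. marked_count \<Phi> H \<omega> \<partial>M)" if "H \<in> sets (M1 \<Otimes>\<^sub>M M2)" for H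
  proof (rule emeasure_measure_of[OF C_def])
    show "sets (M1 \<Otimes>\<^sub>M M2) \<subseteq> Pow (UNIV \<times> space M)"
      using sets.space_closed[of "M1 \<Otimes>\<^sub>M M2"] by (simp add: spaceP)
    show "positive (sets C) (\<lambda>H. \<integral>\<^sup>+\<omega>. marked_count \<Phi> H \<omega> \<partial>M)"
      by (simp add: positive_def marked_count_def)
    show "countably_additive (sets C) (\<lambda>H. \<integral>\<^sup>+\<omega>. marked_count \<Phi> H \<omega> \<partial>M)"
    proof (rule countably_additiveI)
      fix A :: "nat \<Rightarrow> _" assume A: "range A \<subseteq> sets C" "disjoint_family A"
      then have "A i \<in> sets (M1 \<Otimes>\<^sub>M M2)" for i using setsC by auto
      then show "(\<Sum>i. \<integral>\<^sup>+\<omega>. marked_count \<Phi> (A i) \<omega> \<partial>M) = (\<integral>\<^sup>+\<omega>. marked_count \<Phi> (\<Union>i. A i) \<omega> \<partial>M)"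
        by (subst marked_count_suminf[OF A(2)]) (simp add: nn_integral_suminf)
    qed
  qed (use that setsC in auto)
  interpret M2: prob_space M2
    unfolding M2_def using F prob_space_axioms by (rule prob_space_restr_to_subalg)
  have sf1: "sigma_finite_measure M1"
    unfolding M1_def by (subst sigma_finite_measure.sigma_finite_iff_density_finite[OF sigma_finite_lborel]) auto
  have "M1 \<Otimes>\<^sub>M M2 = C"
  proof (rule pair_measure_eqI)
    fix A B assume AB: "A \<in> sets M1" "B \<in> sets M2"
    then have A: "A \<in> sets borel" by (simp add: M1_def)
    \<comment> \<open>The rectangle formula requires a bounded first side, so \<open>A\<close> is
      exhausted by balls and both measures are continuous from below.\<close>
    have un: "A \<times> B = (\<Union>n. (A \<inter> ball 0 (real n)) \<times> B)"
      using reals_Archimedean2 by auto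
    have in_sets: "(A \<inter> ball 0 (real n)) \<times> B \<in> sets (M1 \<Otimes>\<^sub>M M2)" for n
      using AB by (intro pair_measureI) (auto simp: M1_def)
    have eq: "emeasure (M1 \<Otimes>\<^sub>M M2) ((A \<inter> ball 0 (real n)) \<times> B) = emeasure C ((A \<inter> ball 0 (real n)) \<times> B)" for n
    proof -
      have "emeasure C ((A \<inter> ball 0 (real n)) \<times> B) = ennreal lam * emeasure lborel (A \<inter> ball 0 (real n)) * emeasure M B"
        unfolding emC[OF in_sets] using A AB sets2
        by (intro nn_integral_marked_count_Times_bounded[OF _ _ lam indep]) (auto intro: bounded_subset)
      also have "\<dots> = emeasure M1 (A \<inter> ball 0 (real n)) * emeasure M2 B"
        using A AB F sets2 unfolding M1_def M2_def
        by (simp add: emeasure_density nn_integral_cmult_indicator emeasure_restr_to_subalg)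
      also have "\<dots> = emeasure (M1 \<Otimes>\<^sub>M M2) ((A \<inter> ball 0 (real n)) \<times> B)"
        using AB by (intro M2.emeasure_pair_measure_Times[symmetric]) (auto simp: M1_def)
      finally show ?thesis by simp
    qed
    have "emeasure (M1 \<Otimes>\<^sub>M M2) (A \<times> B) = (SUP n. emeasure (M1 \<Otimes>\<^sub>M M2) ((A \<inter> ball 0 (real n)) \<times> B))"
      unfolding un using in_sets by (intro SUP_emeasure_incseq[symmetric]) (auto simp: incseq_ball_Times)
    also have "\<dots> = (SUP n. emeasure C ((A \<inter> ball 0 (real n)) \<times> B))"
      by (simp add: eq)
    also have "\<dots> = emeasure C (A \<times> B)"
      unfolding un using in_sets setsC by (intro SUP_emeasure_incseq) (auto simp: incseq_ball_Times)
    finally show "emeasure M1 A * emeasure M2 B = emeasure C (A \<times> B)"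
      using AB by (simp add: M2.emeasure_pair_measure_Times)
  qed (use sf1 setsC M2.sigma_finite_measure_axioms in auto)
  then have "(\<integral>\<^sup>+\<omega>. marked_count \<Phi> H \<omega> \<partial>M) = emeasure (M1 \<Otimes>\<^sub>M M2) H"
    using H emC setsP by simp
  also have "\<dots> = (\<integral>\<^sup>+x. emeasure M2 (Pair x -` H) \<partial>M1)"
    using H setsP by (intro M2.emeasure_pair_measure_alt) simp
  also have "\<dots> = ennreal lam * (\<integral>\<^sup>+x. emeasure M2 (Pair x -` H) \<partial>lborel)"
    unfolding M1_def using M2.measurable_emeasure_Pair[of H lborel] H setsP
    by (subst nn_integral_density) (auto simp: nn_integral_cmult M1_def cong: measurable_cong_sets)
  also have "(\<integral>\<^sup>+x. emeasure M2 (Pair x -` H) \<partial>lborel)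
      = (\<integral>\<^sup>+x. emeasure M {\<omega> \<in> space M. (x, \<omega>) \<in> H} \<partial>lborel)"
  proof (rule nn_integral_cong)
    fix x
    have "Pair x -` H \<in> sets F" using H by (rule sets_Pair1)
    moreover from this have "Pair x -` H = {\<omega> \<in> space M. (x, \<omega>) \<in> H}"
      using spaceF sets.sets_into_space by fastforce
    ultimately show "emeasure M2 (Pair x -` H) = emeasure M {\<omega> \<in> space M. (x, \<omega>) \<in> H}"
      unfolding M2_def using emeasure_restr_to_subalg[OF F] by simp
  qed
  finally show ?thesis .
qed

end

subsection \<open>Distance to the nearest point\<close>

text \<open>Closed nonempty sets in a Heine-Borel space attain their distance, so the choice behind
  \<open>arg_min_on\<close> has a minimizer to select.\<close>

lemma nearest_in_and_le:
  fixes E :: "'a::heine_borel set"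
  assumes "closed E" "E \<noteq> {}"
  shows "nearest E x \<in> E" "e \<in> E \<Longrightarrow> dist x (nearest E x) \<le> dist x e"
proof -
  obtain z where "z \<in> E" "\<And>y. y \<in> E \<Longrightarrow> dist x z \<le> dist x y"
    using distance_attains_inf[OF assms] by blast
  then have "\<exists>z. is_arg_min (dist x) (\<lambda>e. e \<in> E) z"
    by (intro exI[of _ z]) (auto simp: is_arg_min_def not_less)
  then have "is_arg_min (dist x) (\<lambda>e. e \<in> E) (nearest E x)"
    unfolding nearest_def arg_min_on_def arg_min_def by (rule someI_ex)
  then show "nearest E x \<in> E" "e \<in> E \<Longrightarrow> dist x (nearest E x) \<le> dist x e"
    by (auto simp: is_arg_min_def not_less)
qed

text \<open>The junk value on the empty set is independent of \<open>x\<close>, which keeps the degrees measurable.\<close>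

lemma nearest_empty: "nearest {} x = (SOME e. False)"
  by (simp add: nearest_def arg_min_on_def arg_min_def is_arg_min_def)

text \<open>Packages the events of the process as a measurable space, so that it can be a factor of
  a product and an argument of \<open>subalgebra\<close>.\<close>

definition process_algebra :: "'w measure \<Rightarrow> ('w \<Rightarrow> 'a::euclidean_space set) \<Rightarrow> 'w measure" where
  "process_algebra M \<Phi> = sigma (space M) (point_process_events M \<Phi>)"

context homogeneous_poisson_process
begin

lemma point_process_events_subset: "point_process_events M \<Phi> \<subseteq> events"
  unfolding point_process_events_def
proof (rule sets.sigma_sets_subset, clarify)
  fix A k assume A: "A \<in> sets (borel :: 'a measure)" "bounded A"
  have "(\<lambda>\<omega>. card (\<Phi> \<omega> \<inter> A)) -` {k} \<inter> space M \<in> events"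
    using count_measurable[OF A] by (rule measurable_sets) simp
  also have "(\<lambda>\<omega>. card (\<Phi> \<omega> \<inter> A)) -` {k} \<inter> space M = {\<omega> \<in> space M. card (\<Phi> \<omega> \<inter> A) = k}"
    by auto
  finally show "{\<omega> \<in> space M. card (\<Phi> \<omega> \<inter> A) = k} \<in> events" .
qed

lemma space_process_algebra [simp]: "space (process_algebra M \<Phi>) = space M"
  by (simp add: process_algebra_def space_measure_of_conv)

lemma sets_process_algebra: "sets (process_algebra M \<Phi>) = point_process_events M \<Phi>"
proof -
  have "sets (process_algebra M \<Phi>) = sigma_sets (space M) (point_process_events M \<Phi>)"
    unfolding process_algebra_def
    using point_process_events_subset sets.space_closed by (intro sets_measure_of) blast
  also have "\<dots> = point_process_events M \<Phi>"
    unfolding point_process_events_def by (rule sigma_sets_sigma_sets_eq) auto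
  finally show ?thesis .
qed

lemma subalgebra_process_algebra: "subalgebra M (process_algebra M \<Phi>)"
  using point_process_events_subset by (simp add: subalgebra_def sets_process_algebra)

text \<open>An infinite set has \<open>card\<close> zero, so local finiteness is what makes a zero
  count mean absence of points.\<close>

lemma void_event_eq:
  assumes "bounded A"
  shows "{\<omega> \<in> space M. \<Phi> \<omega> \<inter> A = {}} = {\<omega> \<in> space M. card (\<Phi> \<omega> \<inter> A) = 0}"
  using locally_finite[OF _ assms] by auto

lemma void_event:
  assumes "A \<in> sets borel" "bounded A"
  shows "{\<omega> \<in> space M. \<Phi> \<omega> \<inter> A = {}} \<in> sets (process_algebra M \<Phi>)"
  unfolding void_event_eq[OF assms(2)] sets_process_algebra point_process_events_def
  using assms by (intro sigma_sets.Basic) blast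

lemma prob_void:
  assumes "A \<in> sets borel" "bounded A"
  shows "prob {\<omega> \<in> space M. \<Phi> \<omega> \<inter> A = {}} = exp (- (lam * measure lborel A))"
  unfolding void_event_eq[OF assms(2)] using count_poisson[OF assms, of 0] by simp

lemma empty_event: "{\<omega> \<in> space M. \<Phi> \<omega> = {}} \<in> sets (process_algebra M \<Phi>)"
proof -
  have "{\<omega> \<in> space M. \<Phi> \<omega> = {}} = (\<Inter>n. {\<omega> \<in> space M. \<Phi> \<omega> \<inter> ball 0 (real n) = {}})"
    using reals_Archimedean2 by fastforce
  also have "\<dots> \<in> sets (process_algebra M \<Phi>)"
    by (intro sets.countable_INT') (auto intro: void_event)
  finally show ?thesis .
qed

text \<open>An empty configuration leaves every ball around the origin void, and the void
  probabilities tend to 0 as the radius grows.\<close>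

lemma AE_nonempty:
  assumes lam: "0 < lam"
  shows "AE \<omega> in M. \<Phi> \<omega> \<noteq> {}"
proof -
  let ?E = "{\<omega> \<in> space M. \<Phi> \<omega> = {}}"
  define q where "q = exp (- (lam * unit_ball_vol (real DIM('a))))"
  have E: "?E \<in> events"
    using empty_event subalgebra_process_algebra by (auto simp: subalgebra_def)
  have "prob ?E \<le> q ^ n" for n
  proof (cases "n = 0")
    case False
    have ev: "{\<omega> \<in> space M. \<Phi> \<omega> \<inter> ball 0 (real n) = {}} \<in> events"
      using void_event[of "ball 0 (real n)"] subalgebra_process_algebra by (auto simp: subalgebra_def)
    \<comment> \<open>Since \<open>n \<le> n ^ DIM('a)\<close> for \<open>n \<ge> 1\<close>, the
      volume grows at least linearly in the radius, which makes the bound geometric.\<close>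
    have "real n ^ 1 \<le> real n ^ DIM('a)"
      using False by (intro power_increasing) (auto simp: Suc_leI)
    then have "unit_ball_vol (real DIM('a)) * real n \<le> measure lborel (ball (0::'a) (real n))"
      by (simp add: content_ball mult_left_mono)
    then have "lam * (unit_ball_vol (real DIM('a)) * real n) \<le> lam * measure lborel (ball (0::'a) (real n))"
      using lam by (intro mult_left_mono) auto
    moreover have "prob ?E \<le> prob {\<omega> \<in> space M. \<Phi> \<omega> \<inter> ball 0 (real n) = {}}"
      using ev by (intro finite_measure_mono) auto
    ultimately have "prob ?E \<le> exp (- (lam * (unit_ball_vol (real DIM('a)) * real n)))"
      by (simp add: prob_void) (smt (verit) exp_le_cancel_iff)
    also have "\<dots> = q ^ n" by (simp add: q_def mult_ac flip: exp_of_nat_mult)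
    finally show ?thesis .
  qed simp
  moreover have "(\<lambda>n. q ^ n) \<longlonglongrightarrow> 0"
    using lam by (intro LIMSEQ_realpow_zero) (auto simp: q_def)
  ultimately have "prob ?E \<le> 0"
    by (intro LIMSEQ_le_const) auto
  then have "prob ?E = 0" by (simp add: measure_le_0_iff)
  with E show ?thesis
    by (subst AE_iff_measurable[OF E]) (auto simp: emeasure_eq_measure)
qed

text \<open>Local finiteness excludes accumulation points: inside a unit ball the configuration is
  finite, hence closed.\<close>

lemma closed_process:
  assumes "\<omega> \<in> space M"
  shows "closed (\<Phi> \<omega>)"
proof -
  have "y \<in> \<Phi> \<omega>" if "y \<in> closure (\<Phi> \<omega>)" for y
  proof -
    have "y \<in> closure (ball y 1 \<inter> \<Phi> \<omega>)"
      using that open_Int_closure_subset[of "ball y 1" "\<Phi> \<omega>"] by auto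
    moreover have "closed (ball y 1 \<inter> \<Phi> \<omega>)"
      using locally_finite[OF assms, of "ball y 1"] by (intro finite_imp_closed) (simp add: Int_commute)
    ultimately show ?thesis by auto
  qed
  then show ?thesis using closure_subset_eq by blast
qed

text \<open>The distance is below \<open>a\<close> when some ball that contains a point of the
  process lies well inside the ball of radius \<open>a\<close> around \<open>x\<close>. Countably
  many centres and radii suffice, which yields a countable union of rectangles.\<close>

lemma borel_measurable_dist_nearest:
  "(\<lambda>(x, \<omega>). dist x (nearest (\<Phi> \<omega>) x)) \<in> borel_measurable (borel \<Otimes>\<^sub>M process_algebra M \<Phi>)"
proof (rule borel_measurableI_less)
  fix a
  let ?E = "{\<omega> \<in> space M. \<Phi> \<omega> = {}}"
  obtain D :: "'a set" where D: "countable D" "\<And>X. open X \<Longrightarrow> X \<noteq> {} \<Longrightarrow> \<exists>d\<in>D. d \<in> X"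
    using countable_dense_setE by blast
  \<comment> \<open>A radius \<open>s \<le> 0\<close> contributes nothing: its ball is empty, hence
    always void.\<close>
  let ?T = "\<Union>q\<in>D. \<Union>s\<in>\<rat>. {x. dist x q + s < a} \<times> (space M - {\<omega> \<in> space M. \<Phi> \<omega> \<inter> ball q s = {}})"
  have hit: "\<omega> \<in> space M \<and> (\<exists>e\<in>\<Phi> \<omega>. dist x e < a) \<longleftrightarrow> (x, \<omega>) \<in> ?T" for x \<omega>
  proof
    assume "\<omega> \<in> space M \<and> (\<exists>e\<in>\<Phi> \<omega>. dist x e < a)"
    then obtain e where e: "\<omega> \<in> space M" "e \<in> \<Phi> \<omega>" "dist x e < a" by blast
    \<comment> \<open>With \<open>s\<close> below half the slack and \<open>q\<close> within
      \<open>s\<close> of \<open>e\<close>, the triangle inequality gives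
      \<open>dist x q + s < dist x e + 2 * s < a\<close>.\<close>
    obtain s where s: "s \<in> \<rat>" "0 < s" "s < (a - dist x e) / 2"
      using Rats_dense_in_real[of 0 "(a - dist x e) / 2"] e(3) by auto
    obtain q where q: "q \<in> D" "dist e q < s"
      using D(2)[of "ball e s"] s(2) by auto
    have "dist x q + s < a" using dist_triangle[of x q e] q(2) s(3) by (simp add: field_simps)
    moreover have "e \<in> \<Phi> \<omega> \<inter> ball q s" using e(2) q(2) by (simp add: dist_commute)
    ultimately show "(x, \<omega>) \<in> ?T" using e(1) q(1) s(1) by blast
  next
    assume "(x, \<omega>) \<in> ?T"
    then obtain q s e where "\<omega> \<in> space M" "dist x q + s < a" "e \<in> \<Phi> \<omega>" "dist q e < s"
      by auto
    moreover from this have "dist x e < a" using dist_triangle[of x e q] by simp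
    ultimately show "\<omega> \<in> space M \<and> (\<exists>e\<in>\<Phi> \<omega>. dist x e < a)" by blast
  qed
  \<comment> \<open>The empty configuration adds one more rectangle, because its default nearest
    point is the same for every \<open>x\<close>.\<close>
  have less_iff: "dist x (nearest (\<Phi> \<omega>) x) < a \<longleftrightarrow>
      (\<exists>e\<in>\<Phi> \<omega>. dist x e < a) \<or> \<Phi> \<omega> = {} \<and> dist x (SOME e. False) < a"
    if "\<omega> \<in> space M" for x \<omega>
    using nearest_in_and_le[OF closed_process[OF that], where x = x]
    by (cases "\<Phi> \<omega> = {}") (auto simp: nearest_empty intro: le_less_trans)
  have "{p \<in> space (borel \<Otimes>\<^sub>M process_algebra M \<Phi>). (case p of (x, \<omega>) \<Rightarrow> dist x (nearest (\<Phi> \<omega>) x)) < a}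
     = ?T \<union> {x. dist x (SOME e. False) < a} \<times> ?E" (is "?L = ?R")
  proof (rule set_eqI, clarify)
    fix x \<omega>
    show "(x, \<omega>) \<in> ?L \<longleftrightarrow> (x, \<omega>) \<in> ?R"
      using less_iff[of \<omega> x] hit[of \<omega> x] by (auto simp: space_pair_measure)
  qed
  also have "\<dots> \<in> sets (borel \<Otimes>\<^sub>M process_algebra M \<Phi>)"
  proof (rule sets.Un)
    have "{x. dist x q + s < a} \<times> (space M - {\<omega> \<in> space M. \<Phi> \<omega> \<inter> ball q s = {}})
        \<in> sets (borel \<Otimes>\<^sub>M process_algebra M \<Phi>)" for q s
    proof (rule pair_measureI)
      show "space M - {\<omega> \<in> space M. \<Phi> \<omega> \<inter> ball q s = {}} \<in> sets (process_algebra M \<Phi>)"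
        using sets.compl_sets[OF void_event, of "ball q s"] by simp
    qed auto
    then show "?T \<in> sets (borel \<Otimes>\<^sub>M process_algebra M \<Phi>)"
      using D(1) countable_rat by (intro sets.countable_UN') auto
  next
    have "{x :: 'a. dist x z < a} \<in> sets borel" for z by simp
    then show "{x :: 'a. dist x (SOME e. False) < a} \<times> ?E \<in> sets (borel \<Otimes>\<^sub>M process_algebra M \<Phi>)"
      by (rule pair_measureI[OF _ empty_event])
  qed
  finally show "{p \<in> space (borel \<Otimes>\<^sub>M process_algebra M \<Phi>).
    (case p of (x, \<omega>) \<Rightarrow> dist x (nearest (\<Phi> \<omega>) x)) < a} \<in> sets (borel \<Otimes>\<^sub>M process_algebra M \<Phi>)" .
qed

lemma borel_measurable_dist_nearest_section:
  "(\<lambda>\<omega>. dist x (nearest (\<Phi> \<omega>) x)) \<in> borel_measurable M"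
proof (rule measurable_from_subalg[OF subalgebra_process_algebra])
  have "(\<lambda>\<omega>. (x, \<omega>)) \<in> process_algebra M \<Phi> \<rightarrow>\<^sub>M borel \<Otimes>\<^sub>M process_algebra M \<Phi>"
    by (rule measurable_Pair1') simp
  from measurable_compose[OF this borel_measurable_dist_nearest]
  show "(\<lambda>\<omega>. dist x (nearest (\<Phi> \<omega>) x)) \<in> borel_measurable (process_algebra M \<Phi>)"
    by simp
qed

end

text \<open>The squared distance exceeds \<open>a\<close> when the closed disc of radius
  \<open>sqrt a\<close> is void. Its area \<open>pi * a\<close> is linear in \<open>a\<close>, which
  is why the square of the distance is exponential in the plane.\<close>

lemma distributed_dist_nearest_square:
  fixes \<Phi> :: "'w \<Rightarrow> (real ^ 2) set"
  assumes "homogeneous_poisson_process M lam \<Phi>" and lam: "0 < lam"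
  shows "distributed M lborel (\<lambda>\<omega>. (dist x (nearest (\<Phi> \<omega>) x))\<^sup>2) (exponential_density (pi * lam))"
proof -
  interpret homogeneous_poisson_process M lam \<Phi> by fact
  have [measurable]: "(\<lambda>\<omega>. dist x (nearest (\<Phi> \<omega>) x)) \<in> borel_measurable M"
    by (rule borel_measurable_dist_nearest_section)
  have "prob {\<omega> \<in> space M. (dist x (nearest (\<Phi> \<omega>) x))\<^sup>2 \<le> a} = 1 - exp (- a * (pi * lam))"
    if a: "0 \<le> a" for a
  proof -
    let ?V = "{\<omega> \<in> space M. \<Phi> \<omega> \<inter> cball x (sqrt a) = {}}"
    have V: "?V \<in> events"
      using void_event[of "cball x (sqrt a)"] subalgebra_process_algebra by (auto simp: subalgebra_def)
    have iff: "(dist x (nearest (\<Phi> \<omega>) x))\<^sup>2 \<le> a \<longleftrightarrow> \<omega> \<in> space M - ?V"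
      if "\<omega> \<in> space M" "\<Phi> \<omega> \<noteq> {}" for \<omega>
    proof -
      have "(dist x (nearest (\<Phi> \<omega>) x))\<^sup>2 \<le> a \<longleftrightarrow> dist x (nearest (\<Phi> \<omega>) x) \<le> sqrt a"
        using a by (metis real_le_rsqrt real_sqrt_le_iff real_sqrt_pow2 power_mono zero_le_dist)
      also have "\<dots> \<longleftrightarrow> (\<exists>e\<in>\<Phi> \<omega>. dist x e \<le> sqrt a)"
        using nearest_in_and_le[OF closed_process[OF that(1)] that(2), where x = x] order_trans by blast
      also have "\<dots> \<longleftrightarrow> \<omega> \<in> space M - ?V"
        using that(1) by auto
      finally show ?thesis .
    qed
    \<comment> \<open>The equivalence \<open>iff\<close> presupposes a point of the process, so the
      two events are compared only almost everywhere.\<close>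
    have "prob {\<omega> \<in> space M. (dist x (nearest (\<Phi> \<omega>) x))\<^sup>2 \<le> a} = prob (space M - ?V)"
    proof (rule finite_measure_eq_AE)
      show "AE \<omega> in M. (\<omega> \<in> {\<omega> \<in> space M. (dist x (nearest (\<Phi> \<omega>) x))\<^sup>2 \<le> a}) = (\<omega> \<in> space M - ?V)"
        using AE_nonempty[OF lam] AE_space
      proof eventually_elim
        case (elim \<omega>)
        then show ?case using iff[of \<omega>] by blast
      qed
    qed (use V in auto)
    also have "\<dots> = 1 - exp (- (lam * measure lborel (cball x (sqrt a))))"
      using prob_compl[OF V] prob_void[of "cball x (sqrt a)"] by simp
    also have "measure lborel (cball x (sqrt a)) = pi * a"
      using a by (simp add: content_cball unit_ball_vol_2)
    finally show ?thesis by (simp add: mult_ac)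
  qed
  then show ?thesis
    using lam by (subst exponential_distributed_iff) auto
qed

subsection \<open>Secrecy radius\<close>

text \<open>
  A node whose nearest eavesdropper is at distance \<open>d\<close> has a secure link exactly to the nodes at
  distance \<open>r\<close> with \<open>1 / r powr (2 * b) > c\<^sub>1 / d powr (2 * b) + c\<^sub>2\<close>. Solved for \<open>r\<^sup>2\<close>, with \<open>s = d\<^sup>2\<close>:
\<close>

definition secrecy_radius_sq :: "real \<Rightarrow> real \<Rightarrow> real \<Rightarrow> real \<Rightarrow> real" where
  "secrecy_radius_sq c\<^sub>1 c\<^sub>2 b s = s / (c\<^sub>1 + c\<^sub>2 * s powr b) powr (1 / b)"

lemma secrecy_radius_sq_measurable [measurable]:
  "secrecy_radius_sq c\<^sub>1 c\<^sub>2 b \<in> borel_measurable borel"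
  unfolding secrecy_radius_sq_def by measurable

text \<open>Exponentiating removes the logarithms and leaves a rational inequality in
  \<open>R\<close> and \<open>D\<close>; the increasing power \<open>1 / b\<close> then solves it
  for the squared distance. Positive distances avoid the value 0 of the gain at
  \<open>r = 0\<close>.\<close>

lemma max_secrecy_rate_greater_iff:
  assumes "0 \<le> \<rho>" "0 < \<sigma>l" "0 < \<sigma>e" "0 < P" "0 < b"
    and r: "0 < dist x y" and d: "0 < dist x (nearest E x)"
  shows "max_secrecy_rate (path_loss_gain b) P \<sigma>l \<sigma>e E x y > \<rho> \<longleftrightarrow>
    (dist x y)\<^sup>2 < secrecy_radius_sq (\<sigma>l\<^sup>2 / \<sigma>e\<^sup>2 * 2 powr \<rho>) (\<sigma>l\<^sup>2 / P * (2 powr \<rho> - 1)) b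
      ((dist x (nearest E x))\<^sup>2)"
proof -
  define R where "R = ((dist x y)\<^sup>2) powr b"
  define D where "D = ((dist x (nearest E x))\<^sup>2) powr b"
  define c1 where "c1 = \<sigma>l\<^sup>2 / \<sigma>e\<^sup>2 * 2 powr \<rho>"
  define c2 where "c2 = \<sigma>l\<^sup>2 / P * (2 powr \<rho> - 1)"
  have pos: "0 < R" "0 < D" "0 < c1" "0 \<le> c2"
    using assms by (auto simp: R_def D_def c1_def c2_def ge_one_powr_ge_zero)
  have gain: "path_loss_gain b t = 1 / (t\<^sup>2) powr b" if "0 < t" for t
    using that by (simp add: path_loss_gain_def powr_powr flip: powr_numeral)
  define u where "u = 1 + P * (1 / R) / \<sigma>l\<^sup>2"
  define v where "v = 1 + P * (1 / D) / \<sigma>e\<^sup>2"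
  have uv: "0 < u" "0 < v" using pos assms by (auto simp: u_def v_def intro!: add_pos_nonneg)
  have "max_secrecy_rate (path_loss_gain b) P \<sigma>l \<sigma>e E x y > \<rho> \<longleftrightarrow> \<rho> < log 2 u - log 2 v"
    using \<open>0 \<le> \<rho>\<close> by (auto simp: max_secrecy_rate_def gain[OF r] gain[OF d] u_def v_def R_def D_def)
  also have "\<dots> \<longleftrightarrow> log 2 (v * 2 powr \<rho>) < log 2 u"
    using uv by (simp add: log_mult algebra_simps)
  also have "\<dots> \<longleftrightarrow> v * 2 powr \<rho> < u"
    using uv by simp
  \<comment> \<open>Subtracting 1 and multiplying by \<open>\<sigma>l\<^sup>2 / P\<close> produces
    exactly the constants \<open>c1\<close> and \<open>c2\<close>.\<close>
  also have "\<dots> \<longleftrightarrow> c1 / D + c2 < 1 / R"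
    using assms pos unfolding u_def v_def c1_def c2_def by (simp add: field_simps)
  also have "\<dots> \<longleftrightarrow> R < D / (c1 + c2 * D)"
    using pos by (simp add: field_simps add_pos_nonneg)
  also have "\<dots> \<longleftrightarrow> R powr (1 / b) < (D / (c1 + c2 * D)) powr (1 / b)"
  proof
    assume "R < D / (c1 + c2 * D)"
    then show "R powr (1 / b) < (D / (c1 + c2 * D)) powr (1 / b)"
      using pos \<open>0 < b\<close> by (intro powr_less_mono2) auto
  next
    assume "R powr (1 / b) < (D / (c1 + c2 * D)) powr (1 / b)"
    moreover have "(D / (c1 + c2 * D)) powr (1 / b) \<le> R powr (1 / b)" if "D / (c1 + c2 * D) \<le> R"
      using that pos \<open>0 < b\<close> by (intro powr_mono2) auto
    ultimately show "R < D / (c1 + c2 * D)" by (meson not_less)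
  qed
  also have "R powr (1 / b) = (dist x y)\<^sup>2"
    using r \<open>0 < b\<close> by (simp add: R_def powr_powr)
  also have "(D / (c1 + c2 * D)) powr (1 / b) = secrecy_radius_sq c1 c2 b ((dist x (nearest E x))\<^sup>2)"
    using pos d \<open>0 < b\<close> by (simp add: secrecy_radius_sq_def powr_divide D_def powr_powr)
  finally show ?thesis by (simp add: c1_def c2_def)
qed

section \<open>Concavity of the squared secrecy radius\<close>

context
  fixes c\<^sub>1 c\<^sub>2 b :: real
  assumes c\<^sub>1: "0 < c\<^sub>1" and c\<^sub>2: "0 \<le> c\<^sub>2" and b: "0 < b"
begin

lemma denominator_pos: "0 < c\<^sub>1 + c\<^sub>2 * s powr b"
  using c\<^sub>1 c\<^sub>2 by (simp add: add_pos_nonneg)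

lemma secrecy_radius_sq_nonneg: "0 \<le> s \<Longrightarrow> 0 \<le> secrecy_radius_sq c\<^sub>1 c\<^sub>2 b s"
  by (simp add: secrecy_radius_sq_def)

text \<open>Dropping the nonnegative term with \<open>c\<^sub>2\<close> only shrinks the
  denominator. The linear bound gives integrability against the exponential density.\<close>

lemma secrecy_radius_sq_le: "0 \<le> s \<Longrightarrow> secrecy_radius_sq c\<^sub>1 c\<^sub>2 b s \<le> s / c\<^sub>1 powr (1 / b)"
  unfolding secrecy_radius_sq_def using c\<^sub>1 c\<^sub>2 b denominator_pos[of s]
  by (intro divide_left_mono powr_mono2) auto

lemma has_real_derivative_secrecy_radius_sq:
  assumes "0 < s"
  shows "(secrecy_radius_sq c\<^sub>1 c\<^sub>2 b has_real_derivative
    c\<^sub>1 * (c\<^sub>1 + c\<^sub>2 * s powr b) powr (- 1 / b - 1)) (at s)"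
proof -
  define u where "u = c\<^sub>1 + c\<^sub>2 * s powr b"
  have u: "0 < u" using denominator_pos by (simp add: u_def)
  have "((\<lambda>s. s * (c\<^sub>1 + c\<^sub>2 * s powr b) powr (- 1 / b)) has_real_derivative
      u powr (- 1 / b) + s * ((- 1 / b) * u powr (- 1 / b - 1) * (c\<^sub>2 * (b * s powr (b - 1))))) (at s)"
    using assms u unfolding u_def by (auto intro!: derivative_eq_intros simp: powr_diff field_simps)
  \<comment> \<open>Factoring out \<open>u powr (- 1 / b - 1)\<close> leaves
    \<open>u - c\<^sub>2 * s powr b\<close>, which collapses to the constant
    \<open>c\<^sub>1\<close>.\<close>
  also have "u powr (- 1 / b) + s * ((- 1 / b) * u powr (- 1 / b - 1) * (c\<^sub>2 * (b * s powr (b - 1))))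
      = (u - c\<^sub>2 * s powr b) * u powr (- 1 / b - 1)"
  proof -
    have "u powr (- 1 / b) = u * u powr (- 1 / b - 1)" "s powr b = s * s powr (b - 1)"
      using powr_mult_base[of u "- 1 / b - 1"] powr_mult_base[of s "b - 1"] u assms by simp_all
    with b show ?thesis by (simp add: algebra_simps)
  qed
  also have "u - c\<^sub>2 * s powr b = c\<^sub>1" by (simp add: u_def)
  finally show ?thesis
    by (simp add: secrecy_radius_sq_def[abs_def] u_def powr_minus_divide)
qed

text \<open>The derivative is a constant times a negative power of an expression nondecreasing in
  \<open>s\<close>, so it does not increase. The negated function is therefore convex and lies above
  its tangents.\<close>

lemma secrecy_radius_sq_below_tangent:
  assumes "0 < a" "0 < s"
  shows "secrecy_radius_sq c\<^sub>1 c\<^sub>2 b s \<le> secrecy_radius_sq c\<^sub>1 c\<^sub>2 b a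
    + c\<^sub>1 * (c\<^sub>1 + c\<^sub>2 * a powr b) powr (- 1 / b - 1) * (s - a)"
proof -
  let ?f' = "\<lambda>s. - (c\<^sub>1 * (c\<^sub>1 + c\<^sub>2 * s powr b) powr (- 1 / b - 1))"
  have deriv: "((\<lambda>s. - secrecy_radius_sq c\<^sub>1 c\<^sub>2 b s) has_real_derivative ?f' t) (at t)" if "0 < t" for t
    using has_real_derivative_secrecy_radius_sq[OF that] by (rule DERIV_minus)
  have "convex_on {0<..} (\<lambda>s. - secrecy_radius_sq c\<^sub>1 c\<^sub>2 b s)"
  proof (rule convex_on_realI[where f' = ?f'])
    fix x y :: real assume "x \<in> {0<..}" "y \<in> {0<..}" "x \<le> y"
    then have "c\<^sub>1 + c\<^sub>2 * x powr b \<le> c\<^sub>1 + c\<^sub>2 * y powr b"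
      using c\<^sub>2 b by (intro add_left_mono mult_left_mono powr_mono2) auto
    moreover have "- 1 / b - 1 \<le> 0" using b by (simp add: field_simps)
    ultimately show "?f' x \<le> ?f' y"
      using c\<^sub>1 denominator_pos[of x] by (simp add: powr_mono2')
  qed (use deriv in auto)
  then have "- secrecy_radius_sq c\<^sub>1 c\<^sub>2 b s - - secrecy_radius_sq c\<^sub>1 c\<^sub>2 b a \<ge> ?f' a * (s - a)"
    using assms has_field_derivative_at_within[OF deriv[OF assms(1)]]
    by (intro convex_on_imp_above_tangent[where A = "{0<..}"]) (auto simp: interior_open)
  then show ?thesis by simp
qed

section \<open>Integrals against the exponential density and Jensen's bound\<close>

context
  fixes l :: real
  assumes l: "0 < l"
begin

text \<open>Moments 0 and 1 of the Erlang density with index 0, which is the exponential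
  density.\<close>

lemma has_bochner_integral_exponential_density:
  "has_bochner_integral lborel (exponential_density l) 1"
  "has_bochner_integral lborel (\<lambda>s. exponential_density l s * s) (1 / l)"
  using nn_integral_erlang_ith_moment[OF l, of 0 0] nn_integral_erlang_ith_moment[OF l, of 0 1] l
  by (auto intro!: has_bochner_integral_nn_integral simp: exponential_density_def)

lemma integrable_secrecy_radius_sq_exponential:
  "integrable lborel (\<lambda>s. exponential_density l s * secrecy_radius_sq c\<^sub>1 c\<^sub>2 b s)"
proof (rule Bochner_Integration.integrable_bound)
  show "integrable lborel (\<lambda>s. exponential_density l s * s / c\<^sub>1 powr (1 / b))"
    using has_bochner_integral_exponential_density(2) by (auto simp: has_bochner_integral_iff)
  show "AE s in lborel. norm (exponential_density l s * secrecy_radius_sq c\<^sub>1 c\<^sub>2 b s)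
      \<le> norm (exponential_density l s * s / c\<^sub>1 powr (1 / b))"
  proof (rule AE_I2)
    fix s
    show "norm (exponential_density l s * secrecy_radius_sq c\<^sub>1 c\<^sub>2 b s)
      \<le> norm (exponential_density l s * s / c\<^sub>1 powr (1 / b))"
    proof (cases "0 \<le> s")
      case True
      then show ?thesis
        using secrecy_radius_sq_le[OF True] secrecy_radius_sq_nonneg[OF True] exponential_density_nonneg[OF l, of s]
        by (simp add: abs_mult mult_left_mono flip: times_divide_eq_right)
    qed (simp add: exponential_density_def)
  qed
qed simp

text \<open>The density lives on \<open>s \<ge> 0\<close> and the set integral on
  \<open>s > 0\<close>; the integrand vanishes at 0, so they match pointwise.\<close>

lemma integral_secrecy_radius_sq_exponential_eq:
  "(\<integral>s. exponential_density l s * secrecy_radius_sq c\<^sub>1 c\<^sub>2 b s \<partial>lborel)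
    = l * (LBINT s:{0<..}. s * exp (- l * s) / (c\<^sub>1 + c\<^sub>2 * s powr b) powr (1 / b))"
  unfolding set_lebesgue_integral_def integral_mult_right_zero[symmetric]
  by (intro Bochner_Integration.integral_cong)
    (auto simp: exponential_density_def secrecy_radius_sq_def mult_ac split: split_indicator)

lemma integral_secrecy_radius_sq_exponential_le:
  "(\<integral>s. exponential_density l s * secrecy_radius_sq c\<^sub>1 c\<^sub>2 b s \<partial>lborel) \<le> secrecy_radius_sq c\<^sub>1 c\<^sub>2 b (1 / l)"
proof -
  let ?f = "secrecy_radius_sq c\<^sub>1 c\<^sub>2 b" and ?a = "1 / l"
  \<comment> \<open>The slope of the tangent at the mean \<open>1 / l\<close>. Integrated against
    the density, its linear part \<open>k * (s - 1 / l)\<close> cancels and only the value at the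
    mean remains.\<close>
  define k where "k = c\<^sub>1 * (c\<^sub>1 + c\<^sub>2 * ?a powr b) powr (- 1 / b - 1)"
  have tangent: "has_bochner_integral lborel
      (\<lambda>s. (?f ?a - k * ?a) * exponential_density l s + k * (exponential_density l s * s))
      ((?f ?a - k * ?a) * 1 + k * (1 / l))"
    by (intro has_bochner_integral_add has_bochner_integral_mult_right has_bochner_integral_exponential_density)
  have "(\<integral>s. exponential_density l s * ?f s \<partial>lborel)
      \<le> (\<integral>s. (?f ?a - k * ?a) * exponential_density l s + k * (exponential_density l s * s) \<partial>lborel)"
  proof (rule integral_mono_AE)
    \<comment> \<open>The tangent bound is available only for \<open>s > 0\<close>; negative
      \<open>s\<close> have density 0 and the point 0 is a null set.\<close>
    have "AE s in lborel. s \<noteq> (0::real)" by (rule AE_lborel_singleton)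
    then show "AE s in lborel. exponential_density l s * ?f s
        \<le> (?f ?a - k * ?a) * exponential_density l s + k * (exponential_density l s * s)"
    proof eventually_elim
      case (elim s)
      show ?case
      proof (cases "0 < s")
        case True
        have "exponential_density l s * ?f s \<le> exponential_density l s * (?f ?a + k * (s - ?a))"
          using secrecy_radius_sq_below_tangent[OF _ True, of ?a] l exponential_density_nonneg[OF l, of s]
          by (intro mult_left_mono) (auto simp: k_def)
        then show ?thesis by (simp add: algebra_simps)
      qed (use elim in \<open>simp add: exponential_density_def\<close>)
    qed
  qed (use integrable_secrecy_radius_sq_exponential tangent in \<open>auto simp: has_bochner_integral_iff\<close>)
  also have "\<dots> = ?f ?a" using tangent by (simp add: has_bochner_integral_iff)
  finally show ?thesis .
qed

end

end

section \<open>Mean number of points marked through the nearest point of an independent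
  process\<close>

text \<open>
  For each fixed \<open>x\<close> only the law of the distance from \<open>y x\<close> to the nearest point of \<open>\<Psi>\<close> matters, and it
  does not depend on \<open>y x\<close>. The out-degree is the case \<open>y x = 0\<close> and the in-degree the case
  \<open>y x = x\<close>, which is why their means agree.
\<close>

lemma nn_integral_marked_count_nearest:
  fixes \<Phi> \<Psi> :: "'w \<Rightarrow> (real ^ 2) set"
  assumes \<Phi>: "homogeneous_poisson_process M lam \<Phi>" and \<Psi>: "homogeneous_poisson_process M mu \<Psi>"
    and indep: "indep_point_processes M \<Phi> \<Psi>" and lam: "0 < lam" and mu: "0 < mu"
    and f[measurable]: "f \<in> borel_measurable borel" and f_nonneg: "\<And>s. 0 \<le> s \<Longrightarrow> 0 \<le> f s"
    and H: "H \<in> sets (borel \<Otimes>\<^sub>M process_algebra M \<Psi>)"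
    and H_iff: "\<And>x \<omega>. \<lbrakk>\<omega> \<in> space M; x \<noteq> 0; 0 < dist (y x) (nearest (\<Psi> \<omega>) (y x))\<rbrakk> \<Longrightarrow>
      (x, \<omega>) \<in> H \<longleftrightarrow> (norm x)\<^sup>2 < f ((dist (y x) (nearest (\<Psi> \<omega>) (y x)))\<^sup>2)"
  shows "(\<integral>\<^sup>+\<omega>. marked_count \<Phi> H \<omega> \<partial>M)
    = ennreal lam * (\<integral>\<^sup>+s. ennreal (exponential_density (pi * mu) s) * ennreal (pi * f s) \<partial>lborel)"
proof -
  interpret \<Phi>: homogeneous_poisson_process M lam \<Phi> by fact
  interpret \<Psi>: homogeneous_poisson_process M mu \<Psi> by fact
  note sub = \<Psi>.subalgebra_process_algebra
  let ?D = "\<lambda>z \<omega>. (dist z (nearest (\<Psi> \<omega>) z))\<^sup>2"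
  let ?p = "exponential_density (pi * mu)"
  have law: "distributed M lborel (?D z) ?p" for z
    using distributed_dist_nearest_square[OF \<Psi> mu] .
  \<comment> \<open>The exponential law has no mass at 0, so the positivity premise of
    \<open>H_iff\<close> holds almost surely.\<close>
  have D_pos: "AE \<omega> in M. 0 < ?D z \<omega>" for z
  proof -
    have "AE s in lborel. 0 < ennreal (?p s) \<longrightarrow> 0 < s"
      using AE_lborel_singleton[of "0::real"]
      by eventually_elim (auto simp: exponential_density_def)
    then show ?thesis
      using \<Phi>.distributed_AE2[OF law, of "\<lambda>s. 0 < s"] by simp
  qed
  have "(\<integral>\<^sup>+\<omega>. marked_count \<Phi> H \<omega> \<partial>M)
      = ennreal lam * (\<integral>\<^sup>+x. emeasure M {\<omega> \<in> space M. (x, \<omega>) \<in> H} \<partial>lborel)"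
    using indep \<Psi>.sets_process_algebra unfolding indep_point_processes_def
    by (intro \<Phi>.nn_integral_marked_count[OF lam sub _ H]) simp
  also have "(\<integral>\<^sup>+x. emeasure M {\<omega> \<in> space M. (x, \<omega>) \<in> H} \<partial>lborel)
      = (\<integral>\<^sup>+x. (\<integral>\<^sup>+s. ennreal (?p s) * indicator {s. (norm x)\<^sup>2 < f s} s \<partial>lborel) \<partial>(lborel :: (real ^ 2) measure))"
  proof (rule nn_integral_cong_AE)
    show "AE x in lborel. emeasure M {\<omega> \<in> space M. (x, \<omega>) \<in> H}
      = (\<integral>\<^sup>+s. ennreal (?p s) * indicator {s. (norm x)\<^sup>2 < f s} s \<partial>lborel)"
      using AE_lborel_singleton[of "0 :: real ^ 2"]
    proof eventually_elim
      case (elim x)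
      have "Pair x -` H \<in> sets (process_algebra M \<Psi>)" using H by (rule sets_Pair1)
      moreover from this have "Pair x -` H = {\<omega> \<in> space M. (x, \<omega>) \<in> H}"
        using sets.sets_into_space[of _ "process_algebra M \<Psi>"] by fastforce
      ultimately have "{\<omega> \<in> space M. (x, \<omega>) \<in> H} \<in> sets M"
        using sub by (auto simp: subalgebra_def)
      then have "emeasure M {\<omega> \<in> space M. (x, \<omega>) \<in> H}
          = (\<integral>\<^sup>+\<omega>. indicator {\<omega> \<in> space M. (x, \<omega>) \<in> H} \<omega> \<partial>M)"
        by simp
      also have "\<dots> = (\<integral>\<^sup>+\<omega>. indicator {s. (norm x)\<^sup>2 < f s} (?D (y x) \<omega>) \<partial>M)"
      proof (rule nn_integral_cong_AE)
        show "AE \<omega> in M. (indicator {\<omega> \<in> space M. (x, \<omega>) \<in> H} \<omega> :: ennreal)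
            = indicator {s. (norm x)\<^sup>2 < f s} (?D (y x) \<omega>)"
          using D_pos[of "y x"] AE_space
        proof eventually_elim
          case (elim \<omega>)
          with H_iff[of \<omega> x] \<open>x \<noteq> 0\<close> show ?case by (auto split: split_indicator)
        qed
      qed
      also have "\<dots> = (\<integral>\<^sup>+s. ennreal (?p s) * indicator {s. (norm x)\<^sup>2 < f s} s \<partial>lborel)"
        by (intro distributed_nn_integral[OF law, symmetric]) simp
      finally show ?case .
    qed
  qed
  \<comment> \<open>After the exchange of integrals, fixing \<open>s\<close> turns the set of
    admissible \<open>x\<close> into a disc of squared radius \<open>f s\<close>, with area
    \<open>pi * f s\<close>.\<close>
  also have "\<dots> = (\<integral>\<^sup>+s. (\<integral>\<^sup>+x. ennreal (?p s) * indicator {s. (norm x)\<^sup>2 < f s} s \<partial>(lborel :: (real ^ 2) measure)) \<partial>lborel)"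
    by (rule lborel_pair.Fubini'[symmetric]) simp
  also have "\<dots> = (\<integral>\<^sup>+s. ennreal (?p s) * ennreal (pi * f s) \<partial>lborel)"
  proof (rule nn_integral_cong)
    fix s :: real
    show "(\<integral>\<^sup>+x. ennreal (?p s) * indicator {s. (norm x)\<^sup>2 < f s} s \<partial>(lborel :: (real ^ 2) measure))
        = ennreal (?p s) * ennreal (pi * f s)"
    \<comment> \<open>For negative \<open>s\<close> the sign of \<open>f s\<close> is unknown, but
      the density vanishes there.\<close>
    proof (cases "0 \<le> s")
      case True
      have "(norm x)\<^sup>2 < f s \<longleftrightarrow> x \<in> ball 0 (sqrt (f s))" for x :: "real ^ 2"
        using real_sqrt_less_iff[of "(norm x)\<^sup>2" "f s"] by simp
      then have "(\<integral>\<^sup>+x. ennreal (?p s) * indicator {s. (norm x)\<^sup>2 < f s} s \<partial>(lborel :: (real ^ 2) measure))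
          = (\<integral>\<^sup>+x. ennreal (?p s) * indicator (ball (0 :: real ^ 2) (sqrt (f s))) x \<partial>lborel)"
        by (intro nn_integral_cong) (auto split: split_indicator)
      also have "\<dots> = ennreal (?p s) * emeasure lborel (ball (0 :: real ^ 2) (sqrt (f s)))"
        by (simp add: nn_integral_cmult_indicator)
      also have "emeasure lborel (ball (0 :: real ^ 2) (sqrt (f s))) = ennreal (pi * f s)"
        using f_nonneg[OF True] by (simp add: emeasure_ball unit_ball_vol_2)
      finally show ?thesis .
    qed (simp add: exponential_density_def)
  qed
  finally show ?thesis .
qed

section \<open>Mean degrees of the typical node\<close>

theorem theorem3p4:
  fixes M :: "'w measure"
    and \<Phi>l \<Phi>e :: "'w \<Rightarrow> (real ^ 2) set"
    and lam_l lam_e \<rho> \<sigma>l \<sigma>e P b :: real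
    and N_in N_out :: "'w \<Rightarrow> ennreal"
  assumes "homogeneous_poisson_process M lam_l \<Phi>l"
    and "homogeneous_poisson_process M lam_e \<Phi>e"
    and "indep_point_processes M \<Phi>l \<Phi>e"
    and "lam_l > 0" and "lam_e > 0" and "\<rho> \<ge> 0"
    and "\<sigma>l > 0" and "\<sigma>e > 0" and "P > 0" and "b > 0"
  defines "N_in \<equiv> \<lambda>\<omega>. typical_in_degree (path_loss_gain b) P \<sigma>l \<sigma>e \<rho> (\<Phi>l \<omega>) (\<Phi>e \<omega>)"
    and "N_out \<equiv> \<lambda>\<omega>. typical_out_degree (path_loss_gain b) P \<sigma>l \<sigma>e \<rho> (\<Phi>l \<omega>) (\<Phi>e \<omega>)"
  shows "N_in \<in> borel_measurable M \<and> N_out \<in> borel_measurable M \<and>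
    (\<integral>\<^sup>+\<omega>. N_in \<omega> \<partial>M) = (\<integral>\<^sup>+\<omega>. N_out \<omega> \<partial>M) \<and>
    (\<integral>\<^sup>+\<omega>. N_out \<omega> \<partial>M) = ennreal (pi\<^sup>2 * lam_l * lam_e *
       (LBINT x:{0<..}. x * exp (- pi * lam_e * x) /
          (\<sigma>l\<^sup>2 / \<sigma>e\<^sup>2 * 2 powr \<rho> + \<sigma>l\<^sup>2 / P * (2 powr \<rho> - 1) * x powr b) powr (1 / b))) \<and>
    (\<integral>\<^sup>+\<omega>. N_out \<omega> \<partial>M) \<le> ennreal (lam_l / lam_e *
       (1 / (\<sigma>l\<^sup>2 / \<sigma>e\<^sup>2 * 2 powr \<rho> + \<sigma>l\<^sup>2 / (P * (pi * lam_e) powr b) * (2 powr \<rho> - 1)) powr (1 / b)))"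
proof -
  interpret \<Phi>l: homogeneous_poisson_process M lam_l \<Phi>l by fact
  interpret \<Phi>e: homogeneous_poisson_process M lam_e \<Phi>e by fact
  define c1 where "c1 = \<sigma>l\<^sup>2 / \<sigma>e\<^sup>2 * 2 powr \<rho>"
  define c2 where "c2 = \<sigma>l\<^sup>2 / P * (2 powr \<rho> - 1)"
  have c: "0 < c1" "0 \<le> c2"
    using assms by (auto simp: c1_def c2_def ge_one_powr_ge_zero)
  let ?f = "secrecy_radius_sq c1 c2 b" and ?l = "pi * lam_e"
  let ?rate = "\<lambda>\<omega>. max_secrecy_rate (path_loss_gain b) P \<sigma>l \<sigma>e (\<Phi>e \<omega>)"
  have l: "0 < ?l" using \<open>lam_e > 0\<close> by simp
  \<comment> \<open>The mean squared secrecy radius. Both mean degrees come out as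
    \<open>lam_l * pi * I\<close>.\<close>
  define I where "I = (\<integral>s. exponential_density ?l s * ?f s \<partial>lborel)"
  have I: "ennreal lam_l * (\<integral>\<^sup>+s. ennreal (exponential_density ?l s) * ennreal (pi * ?f s) \<partial>lborel)
      = ennreal (lam_l * pi * I)"
  proof -
    have nonneg: "0 \<le> exponential_density ?l s * ?f s" for s
      using secrecy_radius_sq_nonneg[OF c \<open>b > 0\<close>, of s] exponential_density_nonneg[OF l, of s]
      by (cases "0 \<le> s") (auto simp: exponential_density_def)
    have "(\<integral>\<^sup>+s. ennreal (exponential_density ?l s) * ennreal (pi * ?f s) \<partial>lborel)
        = (\<integral>\<^sup>+s. ennreal pi * ennreal (exponential_density ?l s * ?f s) \<partial>lborel)"
      using exponential_density_nonneg[OF l]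
      by (intro nn_integral_cong) (simp add: ac_simps flip: ennreal_mult')
    also have "\<dots> = ennreal pi * ennreal I"
      unfolding I_def using nonneg integrable_secrecy_radius_sq_exponential[OF c \<open>b > 0\<close> l]
      by (subst nn_integral_cmult) (auto simp: nn_integral_eq_integral)
    finally show ?thesis
      using \<open>lam_l > 0\<close> by (simp add: mult.assoc flip: ennreal_mult')
  qed
  \<comment> \<open>Treats both degrees at once: \<open>y x\<close> is the transmitter, whose
    nearest eavesdropper matters, and \<open>z x\<close> the receiver. One of them will be the
    origin and the other \<open>x\<close>.\<close>
  have degree: "marked_count \<Phi>l H \<in> borel_measurable M \<and>
      (\<integral>\<^sup>+\<omega>. marked_count \<Phi>l H \<omega> \<partial>M) = ennreal (lam_l * pi * I)"
    if H_def: "H = {(x, \<omega>). \<omega> \<in> space M \<and> ?rate \<omega> (y x) (z x) > \<rho>}"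
      and y[measurable]: "y \<in> borel_measurable borel" and z[measurable]: "z \<in> borel_measurable borel"
      and yz: "\<And>x. dist (y x) (z x) = norm x" for H and y z :: "real ^ 2 \<Rightarrow> real ^ 2"
  proof -
    have "(\<lambda>p. dist (y (fst p)) (nearest (\<Phi>e (snd p)) (y (fst p))))
        \<in> borel_measurable (borel \<Otimes>\<^sub>M process_algebra M \<Phi>e)"
      using measurable_compose[OF _ \<Phi>e.borel_measurable_dist_nearest,
          of "\<lambda>p. (y (fst p), snd p)" "borel \<Otimes>\<^sub>M process_algebra M \<Phi>e"] by simp
    note [measurable] = this
    \<comment> \<open>The rate depends on the eavesdroppers only through the distance to the nearest
      one, which is jointly measurable.\<close>
    have "{p \<in> space (borel \<Otimes>\<^sub>M process_algebra M \<Phi>e). ?rate (snd p) (y (fst p)) (z (fst p)) > \<rho>}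
        \<in> sets (borel \<Otimes>\<^sub>M process_algebra M \<Phi>e)"
      unfolding max_secrecy_rate_def path_loss_gain_def by measurable
    also have "{p \<in> space (borel \<Otimes>\<^sub>M process_algebra M \<Phi>e). ?rate (snd p) (y (fst p)) (z (fst p)) > \<rho>} = H"
      by (auto simp: H_def space_pair_measure)
    finally have H: "H \<in> sets (borel \<Otimes>\<^sub>M process_algebra M \<Phi>e)" .
    moreover have "sets (borel \<Otimes>\<^sub>M process_algebra M \<Phi>e) \<subseteq> sets (borel \<Otimes>\<^sub>M M)"
      using \<Phi>e.subalgebra_process_algebra unfolding subalgebra_def sets_pair_measure \<Phi>e.space_process_algebra
      by (intro sigma_sets_mono') auto
    ultimately have "marked_count \<Phi>l H \<in> borel_measurable M"
      by (intro \<Phi>l.measurable_marked_count) auto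
    moreover have "(\<integral>\<^sup>+\<omega>. marked_count \<Phi>l H \<omega> \<partial>M) = ennreal (lam_l * pi * I)"
      unfolding I[symmetric]
    proof (rule nn_integral_marked_count_nearest[OF assms(1-5) _ _ H, where y = y])
      fix x \<omega> assume "\<omega> \<in> space M" "x \<noteq> 0" "0 < dist (y x) (nearest (\<Phi>e \<omega>) (y x))"
      then show "(x, \<omega>) \<in> H \<longleftrightarrow> (norm x)\<^sup>2 < ?f ((dist (y x) (nearest (\<Phi>e \<omega>) (y x)))\<^sup>2)"
        using max_secrecy_rate_greater_iff[OF assms(6-10), of "y x" "z x" "\<Phi>e \<omega>"] yz[of x]
        by (simp add: H_def c1_def c2_def)
    qed (use secrecy_radius_sq_nonneg[OF c \<open>b > 0\<close>] in auto)
    ultimately show ?thesis ..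
  qed
  define H_in H_out where "H_in = {(x, \<omega>). \<omega> \<in> space M \<and> ?rate \<omega> x 0 > \<rho>}"
    and "H_out = {(x, \<omega>). \<omega> \<in> space M \<and> ?rate \<omega> 0 x > \<rho>}"
  \<comment> \<open>Both endpoints lie in the node set with the origin added, so only the rate
    condition remains of the edge relation.\<close>
  have N: "N_in \<omega> = marked_count \<Phi>l H_in \<omega>" "N_out \<omega> = marked_count \<Phi>l H_out \<omega>" if "\<omega> \<in> space M" for \<omega>
    using that unfolding N_in_def N_out_def typical_in_degree_def typical_out_degree_def
      marked_count_def iS_graph_def H_in_def H_out_def
    by (auto intro!: arg_cong[where f = "emeasure (count_space UNIV)"])
  have "marked_count \<Phi>l H_in \<in> borel_measurable M \<and>
      (\<integral>\<^sup>+\<omega>. marked_count \<Phi>l H_in \<omega> \<partial>M) = ennreal (lam_l * pi * I)"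
    by (rule degree[of _ "\<lambda>x. x" "\<lambda>_. 0"]) (auto simp: H_in_def)
  then have in_deg: "N_in \<in> borel_measurable M" "(\<integral>\<^sup>+\<omega>. N_in \<omega> \<partial>M) = ennreal (lam_l * pi * I)"
    using N by (simp_all cong: measurable_cong nn_integral_cong)
  have "marked_count \<Phi>l H_out \<in> borel_measurable M \<and>
      (\<integral>\<^sup>+\<omega>. marked_count \<Phi>l H_out \<omega> \<partial>M) = ennreal (lam_l * pi * I)"
    by (rule degree[of _ "\<lambda>_. 0" "\<lambda>x. x"]) (auto simp: H_out_def)
  then have out_deg: "N_out \<in> borel_measurable M" "(\<integral>\<^sup>+\<omega>. N_out \<omega> \<partial>M) = ennreal (lam_l * pi * I)"
    using N by (simp_all cong: measurable_cong nn_integral_cong)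
  \<comment> \<open>One factor \<open>pi\<close> is the area of the unit disc, the other comes from
    the exponential rate \<open>pi * lam_e\<close>.\<close>
  have degree_eq: "lam_l * pi * I = pi\<^sup>2 * lam_l * lam_e * (LBINT x:{0<..}. x * exp (- pi * lam_e * x) /
      (c1 + c2 * x powr b) powr (1 / b))"
    unfolding I_def integral_secrecy_radius_sq_exponential_eq[OF c \<open>b > 0\<close> l]
    by (simp add: power2_eq_square mult_ac)
  have bound: "lam_l * pi * I \<le> lam_l / lam_e * (1 / (c1 + c2 / (pi * lam_e) powr b) powr (1 / b))"
  proof -
    have "lam_l * pi * I \<le> lam_l * pi * ?f (1 / ?l)"
      unfolding I_def using \<open>lam_l > 0\<close> integral_secrecy_radius_sq_exponential_le[OF c \<open>b > 0\<close> l]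
      by (intro mult_left_mono) auto
    \<comment> \<open>At \<open>s = 1 / (pi * lam_e)\<close> the numerator cancels the factor
      \<open>pi\<close> and supplies \<open>1 / lam_e\<close>.\<close>
    also have "\<dots> = lam_l / lam_e * (1 / (c1 + c2 / (pi * lam_e) powr b) powr (1 / b))"
      using l by (simp add: secrecy_radius_sq_def powr_divide)
    finally show ?thesis .
  qed
  have c2_div: "c2 / (pi * lam_e) powr b = \<sigma>l\<^sup>2 / (P * (pi * lam_e) powr b) * (2 powr \<rho> - 1)"
    by (simp add: c2_def)
  show ?thesis
    unfolding c1_def[symmetric] c2_def[symmetric] c2_div[symmetric] degree_eq[symmetric] in_deg(2) out_deg(2)
    by (intro conjI in_deg(1) out_deg(1) ennreal_leI[OF bound] refl)
qed

end
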